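(* Let $B\in\mathbb{R}_+^{n\times n}$ be a row uniform nonnegative matrix and let $$\sigma(B)=\{\lambda\in\mathbb{C}: \exists A\in\mathbb{C}^{n\times n},\ \operatorname{Aux}(|A|)=B,\ \det(A-\lambda I)=0\}.$$ The following are equivalent: (i) $0\in\sigma(B)$. (ii) The number of nonzero generalized diagonal products of $B$ is not $1$.
   Context: $\mathbb{R}_+$ denotes the nonnegative reals. For a complex matrix $A$, $|A|$ is the matrix of the moduli of its entries. For $A=(a_{ij})\in\mathbb{R}_+^{n\times n}$, the auxiliary matrix $\operatorname{Aux}(A)=(b_{ij})$ is defined by $b_{ij}=\sum_k a_{ik}$ if $a_{ij}\neq0$ and $b_{ij}=0$ if $a_{ij}=0$. A nonnegative matrix is row uniform if, in every row, all nonzero entries are equal. A generalized diagonal product of $B=(b_{ij})$ is a product $\prod_{i=1}^n b_{i\pi(i)}$ where $\pi$ is a permutation of $\{1,\dots,n\}$; generalized diagonal products are counted by permutations, so the number of nonzero ones is the number of permutations $\pi$ with $\prod_{i=1}^n b_{i\pi(i)}\neq0$. *)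

theory Defs
  imports "HOL-Analysis.Analysis"
begin

definition nonneg_matrix :: "real^'n^'n \<Rightarrow> bool" where
  "nonneg_matrix A \<longleftrightarrow> (\<forall>i j. 0 \<le> A $ i $ j)"

definition matrix_modulus :: "complex^'n^'n \<Rightarrow> real^'n^'n" where
  "matrix_modulus A = (\<chi> i j. cmod (A $ i $ j))"

definition Aux :: "real^'n^'n \<Rightarrow> real^'n^'n" where
  "Aux A = (\<chi> i j. if A $ i $ j \<noteq> 0 then (\<Sum>k\<in>UNIV. A $ i $ k) else 0)"

definition row_uniform :: "real^'n^'n \<Rightarrow> bool" where
  "row_uniform B \<longleftrightarrow>
     (\<forall>i j k. B $ i $ j \<noteq> 0 \<longrightarrow> B $ i $ k \<noteq> 0 \<longrightarrow> B $ i $ j = B $ i $ k)"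

text \<open>\<open>mat l\<close> is the scalar matrix \<open>l I\<close>.\<close>

definition aux_spectrum :: "real^'n^'n \<Rightarrow> complex set" where
  "aux_spectrum B =
     {l. \<exists>A :: complex^'n^'n. Aux (matrix_modulus A) = B \<and> det (A - mat l) = 0}"

definition gen_diag_prod :: "real^'n^'n \<Rightarrow> ('n \<Rightarrow> 'n) \<Rightarrow> real" where
  "gen_diag_prod B p = (\<Prod>i\<in>UNIV. B $ i $ p i)"

text \<open>Counted by permutations, not by distinct values of the product.\<close>

definition num_nonzero_gen_diag_prods :: "real^'n^'n \<Rightarrow> nat" where
  "num_nonzero_gen_diag_prods B = card {p. p permutes UNIV \<and> gen_diag_prod B p \<noteq> 0}"

end

theory Submission
  imports Defs "HOL-Computational_Algebra.Fundamental_Theorem_Algebra" "HOL-Library.Nat_Bijection"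
begin

text \<open>
  Every \<open>A\<close> with \<open>Aux |A| = B\<close> has the zero pattern of \<open>B\<close>; conversely, since \<open>B\<close> is row uniform,
  every complex matrix with this pattern becomes such an \<open>A\<close> after rescaling its rows by positive
  factors, which does not affect whether the determinant vanishes. So the question is when some
  matrix with the pattern of \<open>B\<close> is singular. If exactly one permutation is supported on the
  pattern, the determinant is a single nonzero term. Otherwise put \<open>t ^ w i j\<close> at the nonzero
  positions, where the weights \<open>w i j\<close> are distinct powers of \<open>2\<close>. Distinct permutations have distinct
  weights, so the determinant is a polynomial in \<open>t\<close> with no cancellation: it is zero or has
  at least two monomials, and in either case it has a nonzero complex root.
\<close>

text \<open>Divide out the full power of the variable. The cofactor \<open>g\<close> does not vanish
  at 0, and it is not constant, since otherwise \<open>f\<close> would be a monomial with just one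
  nonzero coefficient. So \<open>g\<close> has a root, and that root is nonzero.\<close>

lemma nonzero_root_exists:
  fixes f :: "complex poly"
  assumes "coeff f m \<noteq> 0" "coeff f n \<noteq> 0" "m \<noteq> n"
  obtains t where "t \<noteq> 0" "poly f t = 0"
proof -
  from assms have "f \<noteq> 0" by auto
  then obtain g where f: "f = [:- 0, 1:] ^ order 0 f * g" and g: "\<not> [:- 0, 1:] dvd g"
    using order_decomp by blast
  have f': "f = monom 1 (order 0 f) * g"
    using f by (simp add: monom_altdef)
  have "\<not> constant (poly g)"
  proof
    assume "constant (poly g)"
    then obtain c where "g = [:c:]"
      by (metis constant_degree degree_eq_zeroE)
    then have "f = monom c (order 0 f)"
      using f' by (simp add: mult.commute[of _ "[:c:]"] smult_monom)
    then show False
      using assms by (metis coeff_monom)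
  qed
  then obtain t where t: "poly g t = 0"
    using fundamental_theorem_of_algebra by blast
  show thesis
  proof
    show "t \<noteq> 0" using g t by (auto simp: poly_eq_0_iff_dvd)
    show "poly f t = 0" using t by (subst f') simp
  qed
qed

lemma poly_det:
  fixes M :: "'a::comm_ring_1 poly^'n^'n"
  shows "poly (det M) t = det (\<chi> i j. poly (M $ i $ j) t)"
proof -
  have "poly (of_int k) t = of_int k" for k :: int
    by (simp add: of_int_poly)
  then show ?thesis by (simp add: det_def poly_sum poly_prod)
qed

lemma singular_matrix_with_pattern:
  fixes S :: "'n::finite \<Rightarrow> 'n \<Rightarrow> bool"
  assumes "card {p. p permutes UNIV \<and> (\<forall>i. S i (p i))} \<noteq> 1"
  obtains C :: "complex^'n^'n"
  where "\<And>i j. C $ i $ j \<noteq> 0 \<longleftrightarrow> S i j" "det C = 0"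
proof -
  define P where "P = {p. p permutes (UNIV::'n set) \<and> (\<forall>i. S i (p i))}"
  obtain e :: "'n \<times> 'n \<Rightarrow> nat" where e: "inj e"
    using finite_imp_inj_to_nat_seg[of "UNIV :: ('n \<times> 'n) set"] by auto
  define w where "w i j = (2::nat) ^ e (i, j)" for i j
  define W where "W p = (\<Sum>i\<in>UNIV. w i (p i))" for p
  define M where "M = (\<chi> i j. if S i j then monom (1::complex) (w i j) else 0)"
  define f where "f = det M"
  \<comment> \<open>The binary digits of \<open>W p\<close> mark the codes of the pairs
    \<open>(i, p i)\<close>, so \<open>W p\<close> determines the graph of \<open>p\<close> and
    hence \<open>p\<close>.\<close>
  have W_eq: "W p = set_encode (e ` range (\<lambda>i. (i, p i)))" for p
    unfolding W_def w_def set_encode_def image_image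
    by (subst sum.reindex) (auto intro!: inj_onI dest: injD[OF e])
  have inj_W: "inj W"
  proof (rule injI)
    fix p q assume "W p = W q"
    then have "e ` range (\<lambda>i. (i, p i)) = e ` range (\<lambda>i. (i, q i))"
      unfolding W_eq by (subst (asm) set_encode_eq) auto
    then have "range (\<lambda>i. (i, p i)) = range (\<lambda>i. (i, q i))"
      using e by (simp add: inj_image_eq_iff)
    then show "p = q" by auto
  qed
  have prod_M: "(\<Prod>i\<in>UNIV. M $ i $ p i) = (if \<forall>i. S i (p i) then monom 1 (W p) else 0)" for p
  proof -
    have "(\<Prod>i\<in>A. monom (1::complex) (w i (p i))) = monom 1 (\<Sum>i\<in>A. w i (p i))" if "finite A" for A
      using that by induction (auto simp: mult_monom)
    then show ?thesis unfolding M_def W_def by auto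
  qed
  have fin: "finite P"
    unfolding P_def by (rule finite_subset[OF _ finite_permutations[of "UNIV::'n set"]]) auto
  have "f = (\<Sum>p\<in>P. of_int (sign p) * monom 1 (W p))"
    unfolding f_def det_def prod_M P_def
    by (rule sum.mono_neutral_cong_right) (auto simp: finite_permutations)
  then have coeff_f: "coeff f k = (\<Sum>p\<in>P. of_int (sign p) * (if k = W p then 1 else 0))" for k
    by (auto simp: coeff_sum of_int_poly intro!: sum.cong)
  have coeff_W: "coeff f (W q) \<noteq> 0" if "q \<in> P" for q
  proof -
    \<comment> \<open>By injectivity of \<open>W\<close>, only \<open>q\<close> contributes to this
      coefficient, which is therefore 1 or -1.\<close>
    have "coeff f (W q) = (\<Sum>p\<in>P. if p = q then of_int (sign q) else 0)"
      unfolding coeff_f by (intro sum.cong) (auto dest: injD[OF inj_W])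
    then show ?thesis using that fin by (simp add: sign_def)
  qed
  obtain t where t: "t \<noteq> 0" "poly f t = 0"
  proof (cases "P = {}")
    case True
    then have "f = 0" using coeff_f by (simp add: poly_eq_iff)
    \<comment> \<open>Every number is a root of the zero polynomial; 1 is a nonzero one.\<close>
    then show thesis using that[of 1] by simp
  next
    case False
    then obtain p where p: "p \<in> P" by auto
    have "P \<noteq> {p}" using assms unfolding P_def by auto
    then obtain q where q: "q \<in> P" "p \<noteq> q" using p by blast
    then have "W p \<noteq> W q" using inj_W by (auto dest: injD)
    then show thesis
      using nonzero_root_exists coeff_W p q that by blast
  qed
  show thesis
  proof (rule that)
    \<comment> \<open>Powers of a nonzero \<open>t\<close> are nonzero, so evaluation preserves the
      pattern.\<close>
    show "(\<chi> i j. poly (M $ i $ j) t) $ i $ j \<noteq> 0 \<longleftrightarrow> S i j" for i j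
      using t(1) by (simp add: M_def poly_monom)
    show "det (\<chi> i j. poly (M $ i $ j) t) = 0"
      using t(2) by (simp add: f_def poly_det)
  qed
qed

text \<open>A row sum of moduli dominates each modulus in the row, so a nonzero entry cannot meet a
  zero row sum.\<close>

lemma Aux_modulus_eq_0_iff:
  "Aux (matrix_modulus A) $ i $ j = 0 \<longleftrightarrow> A $ i $ j = 0"
proof -
  have "cmod (A $ i $ j) \<le> (\<Sum>k\<in>UNIV. cmod (A $ i $ k))"
    by (rule member_le_sum) auto
  then show ?thesis by (auto simp: Aux_def matrix_modulus_def)
qed

lemma row_scaling_Aux:
  fixes B :: "real^'n^'n" and C :: "complex^'n^'n"
  assumes "nonneg_matrix B" "row_uniform B"
    and C: "\<And>i j. C $ i $ j \<noteq> 0 \<longleftrightarrow> B $ i $ j \<noteq> 0"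
  obtains c where "Aux (matrix_modulus (\<chi> i. complex_of_real (c i) *s C $ i)) = B"
proof -
  \<comment> \<open>The target row sum: the common nonzero value of the row of \<open>B\<close>, or
    1 as a default if that row is zero.\<close>
  have "\<exists>r>0. \<forall>j. B $ i $ j \<noteq> 0 \<longrightarrow> B $ i $ j = r" for i
  proof (cases "\<exists>j. B $ i $ j \<noteq> 0")
    case True
    then obtain j where "B $ i $ j \<noteq> 0" by blast
    moreover from this have "B $ i $ j > 0"
      using assms(1) by (simp add: nonneg_matrix_def order.not_eq_order_implies_strict)
    ultimately show ?thesis using assms(2) unfolding row_uniform_def by blast
  qed (auto intro: exI[of _ 1])
  then obtain r where r: "\<And>i. r i > 0" "\<And>i j. B $ i $ j \<noteq> 0 \<Longrightarrow> B $ i $ j = r i"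
    by metis
  define s where "s i = (\<Sum>j\<in>UNIV. cmod (C $ i $ j))" for i
  have s_ge: "cmod (C $ i $ j) \<le> s i" for i j
    unfolding s_def by (rule member_le_sum) auto
  have s0: "s i > 0" if "B $ i $ j \<noteq> 0" for i j
    using that C[of i j] s_ge[of i j] by (smt (verit) zero_less_norm_iff)
  have s_nonneg: "s i \<ge> 0" for i unfolding s_def by (simp add: sum_nonneg)
  \<comment> \<open>Dividing by \<open>s i\<close> brings the moduli in a nonzero row to sum 1, and
    \<open>r i\<close> then gives the target sum. In a zero row \<open>s i = 0\<close>, and the row
    stays zero.\<close>
  define A where "A = (\<chi> i. complex_of_real (r i / s i) *s C $ i)"
  have mod_A: "cmod (A $ i $ j) = r i / s i * cmod (C $ i $ j)" for i j
    using r(1)[of i] s_nonneg[of i] by (simp add: A_def norm_mult norm_divide)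
  have "Aux (matrix_modulus A) $ i $ j = B $ i $ j" for i j
  proof (cases "B $ i $ j = 0")
    case True
    then show ?thesis using C[of i j] by (simp add: Aux_modulus_eq_0_iff A_def)
  next
    case False
    have "(\<Sum>k\<in>UNIV. cmod (A $ i $ k)) = r i"
      using s0[OF False] unfolding mod_A sum_distrib_left[symmetric] s_def[symmetric] by simp
    moreover have "cmod (A $ i $ j) \<noteq> 0"
      using r(1)[of i] s0[OF False] C[of i j] False unfolding mod_A by simp
    ultimately show ?thesis
      using r(2)[OF False] by (simp add: Aux_def matrix_modulus_def)
  qed
  then have "Aux (matrix_modulus A) = B" by (simp add: vec_eq_iff)
  then show thesis unfolding A_def by (rule that)
qed

lemma det_nonzero_if_unique_supported_permutation:
  fixes A :: "'a::idom^'n^'n"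
  assumes "{p. p permutes UNIV \<and> (\<forall>i. A $ i $ p i \<noteq> 0)} = {q}"
  shows "det A \<noteq> 0"
proof -
  have "det A = (\<Sum>p\<in>{q}. of_int (sign p) * (\<Prod>i\<in>UNIV. A $ i $ p i))"
    unfolding det_def
    by (rule sum.mono_neutral_right) (use assms in \<open>auto simp: finite_permutations prod_zero_iff\<close>)
  moreover have "(\<Prod>i\<in>UNIV. A $ i $ q i) \<noteq> 0" using assms by auto
  ultimately show ?thesis by (simp add: sign_def)
qed

theorem theorem4p2:
  fixes B :: "real^'n^'n"
  assumes "nonneg_matrix B" and "row_uniform B"
  shows "0 \<in> aux_spectrum B \<longleftrightarrow> num_nonzero_gen_diag_prods B \<noteq> 1"
proof -
  have num: "num_nonzero_gen_diag_prods B =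
      card {p. p permutes UNIV \<and> (\<forall>i. B $ i $ p i \<noteq> 0)}"
    by (simp add: num_nonzero_gen_diag_prods_def gen_diag_prod_def)
  have spec: "0 \<in> aux_spectrum B \<longleftrightarrow>
      (\<exists>A :: complex^'n^'n. Aux (matrix_modulus A) = B \<and> det A = 0)"
    by (simp add: aux_spectrum_def)
  show ?thesis
  proof
    assume "0 \<in> aux_spectrum B"
    then obtain A :: "complex^'n^'n" where A: "Aux (matrix_modulus A) = B" "det A = 0"
      using spec by blast
    \<comment> \<open>With equal zero patterns, \<open>A\<close> and \<open>B\<close> have the same
      supported permutations.\<close>
    have "B $ i $ j = 0 \<longleftrightarrow> A $ i $ j = 0" for i j
      unfolding A(1)[symmetric] by (rule Aux_modulus_eq_0_iff)
    then show "num_nonzero_gen_diag_prods B \<noteq> 1"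
      using A(2) det_nonzero_if_unique_supported_permutation[of A]
      unfolding num by (auto simp: card_1_singleton_iff)
  next
    assume "num_nonzero_gen_diag_prods B \<noteq> 1"
    then obtain C :: "complex^'n^'n"
      where C: "\<And>i j. C $ i $ j \<noteq> 0 \<longleftrightarrow> B $ i $ j \<noteq> 0" "det C = 0"
      using singular_matrix_with_pattern[of "\<lambda>i j. B $ i $ j \<noteq> 0"] unfolding num by blast
    obtain c where "Aux (matrix_modulus (\<chi> i. complex_of_real (c i) *s C $ i)) = B"
      using row_scaling_Aux[OF assms C(1)] .
    \<comment> \<open>The row factors come out of the determinant as the product of all
      \<open>c i\<close>.\<close>
    moreover have "det (\<chi> i. complex_of_real (c i) *s C $ i) = 0"
      using C(2) by (simp add: det_rows_mul)
    ultimately show "0 \<in> aux_spectrum B" using spec by blast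
  qed
qed

end
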